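(* Let $W=W(A_n)$ with simple system $\Pi$. Given $J\subseteq M\subseteq \Pi$, let $$\Theta_J:\textstyle\sum_{W_J}(A_n)\to PB(W_J)\quad\text{and}\quad \Theta_M:\sum_{W_M}(A_n)\to PB(W_M)$$ be the canonical homomorphisms. Then $$\Theta_J\,\mathrm{res}_J^M=\mathrm{res}_{W_J}^{W_M}\,\Theta_M$$ and $$\Theta_M\,\mathrm{ind}_J^M=\mathrm{ind}_{W_J}^{W_M}\,\Theta_J,$$ where $\mathrm{res}_{W_J}^{W_M}:PB(W_M)\to PB(W_J)$ and $\mathrm{ind}_{W_J}^{W_M}:PB(W_J)\to PB(W_M)$ are given by $$\mathrm{res}_{W_J}^{W_M}(W_M/W_K)=\sum_{d\in W_M\cap X_{KJ}}W_J/W_{J\cap d^{-1}(K)},\qquad \mathrm{ind}_{W_J}^{W_M}(W_J/W_K)=W_M/W_K.$$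
   Context: Let $e_1,\dots,e_{n+1}$ be an orthonormal basis of a Euclidean space of dimension $n+1$, $\Phi=\{e_i-e_j : i\ne j\}$ the root system of type $A_n$, $\Pi=\{e_i-e_{i+1} : 1\le i\le n\}$ its simple system, $\Phi^+$ the corresponding positive system, and $W=W(A_n)$ the Weyl group generated by the reflections $w_r$, $r\in\Phi$. For $J\subseteq\Pi$, $W_J$ is the standard parabolic subgroup generated by $w_r$, $r\in J$, and $X_J=\{w\in W : w(J)\subseteq\Phi^+\}$ is the set of distinguished (minimal length) representatives of the cosets $wW_J$. Put $X_{JK}=X_J^{-1}\cap X_K$, the set of distinguished representatives of the double cosets $W_JwW_K$. For $J,K\subseteq\Pi$ write $J\sim K$ if $K=w(J)$ for some $w\in W$. For $K\subseteq J\subseteq\Pi$ let $x_K^J=\sum_{d\in W_J\cap X_K}d$, and let $[x_K^J]=\{x_L^J : L\sim K,\ L\subseteq J\}$ (so the conjugating element is allowed to be any $w\in W$). The algebra $\sum_{W_J}(A_n)$ is the span of the classes $[x_K^J]$, $K\subseteq J$, which form its basis, with multiplication $[x_K^J][x_N^J]=[x_K^Jx_N^J]=\sum_{P\subseteq N}a_{KNP}^J[x_P^J]$ for $K,N\subseteq J$, where $a_{KNP}^J$ is the number of $w\in W_J\cap X_{KN}$ with $w^{-1}(K)\cap N=P$. For $J\subseteq M\subseteq\Pi$, the induction map $\mathrm{ind}_J^M:\sum_{W_J}(A_n)\to\sum_{W_M}(A_n)$ is defined by $\mathrm{ind}_J^M([x_K^J])=[x_J^M][x_K^J]$ for $K\subseteq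 J$, where this product means $[x_J^Mx_K^J]=[x_K^M]$. The restriction map $\mathrm{res}_J^M:\sum_{W_M}(A_n)\to\sum_{W_J}(A_n)$ is defined, for $K\subseteq M$, by $$\mathrm{res}_J^M([x_K^M])=\sum_{d\in W_M\cap X_{KJ}}[x^J_{J\cap d^{-1}(K)}]=\sum_{d\in W_M\cap X_{JK}}[x^J_{J\cap d(K)}].$$ $PB(W_J)$ is the parabolic Burnside ring of $W_J$ (with rational coefficients), spanned by the isomorphism classes of the transitive $W_J$-sets $W_J/W_K$, $K\subseteq J$. The canonical homomorphism $\Theta_J:\sum_{W_J}(A_n)\to PB(W_J)$ is given by $\Theta_J([x_K^J])=W_J/W_K$ for $K\subseteq J$; similarly for $\Theta_M$.
   Formalization: The maps are assumed to exist as well-defined linear maps; with ∼ taken under all of W, Θ_J is ill-defined when J has two or more components (e.g. J={e1−e2,e3−e4}: [x_K]=[x_L] but W_J/W_K≇W_J/W_L), so the result has content only for connected (or empty) J and M. *)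

theory Defs
  imports "HOL-Analysis.Euclidean_Space" "HOL-Algebra.Group_Action" "HOL-Algebra.Generated_Groups"
    "HOL-Library.Poly_Mapping"
begin

text \<open>Throughout, \<open>e 1, \<dots>, e (n + 1)\<close> is the orthonormal basis from which the root system of type
  \<open>A\<^sub>n\<close> is built. The values of \<open>e\<close> at other indices are irrelevant.\<close>

definition onb :: "(nat \<Rightarrow> 'a::euclidean_space) \<Rightarrow> nat \<Rightarrow> bool" where
  "onb e n \<longleftrightarrow> DIM('a) = n + 1 \<and>
     (\<forall>i\<in>{1..n+1}. \<forall>j\<in>{1..n+1}. inner (e i) (e j) = (if i = j then 1 else 0))"

definition roots :: "(nat \<Rightarrow> 'a::euclidean_space) \<Rightarrow> nat \<Rightarrow> 'a set" where
  "roots e n = {e i - e j | i j. i \<in> {1..n+1} \<and> j \<in> {1..n+1} \<and> i \<noteq> j}"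

definition simple_roots :: "(nat \<Rightarrow> 'a::euclidean_space) \<Rightarrow> nat \<Rightarrow> 'a set" where
  "simple_roots e n = {e i - e (i + 1) | i. i \<in> {1..n}}"

definition pos_roots :: "(nat \<Rightarrow> 'a::euclidean_space) \<Rightarrow> nat \<Rightarrow> 'a set" where
  "pos_roots e n = {r \<in> roots e n.
     \<exists>c. (\<forall>s\<in>simple_roots e n. 0 \<le> c s) \<and> r = (\<Sum>s\<in>simple_roots e n. c s *\<^sub>R s)}"

type_synonym 'a endo = "'a \<Rightarrow> 'a"

definition reflection :: "'a::euclidean_space \<Rightarrow> 'a endo" where
  "reflection r v = v - (2 * inner v r / inner r r) *\<^sub>R r"

text \<open>Since \<open>extensional UNIV = UNIV\<close>, the group \<open>BijGroup UNIV\<close> consists of all bijections of the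
  space, with composition as product.\<close>

definition refl_group :: "'a::euclidean_space set \<Rightarrow> 'a endo set" where
  "refl_group R = generate (BijGroup UNIV) (reflection ` R)"

definition Weyl :: "(nat \<Rightarrow> 'a::euclidean_space) \<Rightarrow> nat \<Rightarrow> 'a endo set" where
  "Weyl e n = refl_group (roots e n)"

abbreviation parabolic :: "'a::euclidean_space set \<Rightarrow> 'a endo set" where
  "parabolic J \<equiv> refl_group J"

definition X :: "(nat \<Rightarrow> 'a::euclidean_space) \<Rightarrow> nat \<Rightarrow> 'a set \<Rightarrow> 'a endo set" where
  "X e n J = {w \<in> Weyl e n. w ` J \<subseteq> pos_roots e n}"

definition XX :: "(nat \<Rightarrow> 'a::euclidean_space) \<Rightarrow> nat \<Rightarrow> 'a set \<Rightarrow> 'a set \<Rightarrow> 'a endo set" where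
  "XX e n J K = inv_into UNIV ` X e n J \<inter> X e n K"

text \<open>The conjugating element ranges over all of \<open>W\<close>, also when \<open>K\<close> and \<open>L\<close> are regarded
  as subsets of some smaller \<open>J\<close>.\<close>

definition conj_subsets :: "(nat \<Rightarrow> 'a::euclidean_space) \<Rightarrow> nat \<Rightarrow> 'a set \<Rightarrow> 'a set \<Rightarrow> bool" where
  "conj_subsets e n K L \<longleftrightarrow> (\<exists>w\<in>Weyl e n. L = w ` K)"


text \<open>A rational vector space with basis \<open>B\<close> is represented by the finitely supported functions with
  keys in \<open>B\<close>; the basis vector of \<open>b\<close> is \<open>Poly_Mapping.single b 1\<close>.\<close>

definition free_space :: "'b set \<Rightarrow> ('b \<Rightarrow>\<^sub>0 rat) set" where
  "free_space B = {p. Poly_Mapping.keys p \<subseteq> B}"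

definition smul :: "rat \<Rightarrow> ('b \<Rightarrow>\<^sub>0 rat) \<Rightarrow> ('b \<Rightarrow>\<^sub>0 rat)" where
  "smul c p = Poly_Mapping.map ((*) c) p"

definition linear_between ::
    "('b \<Rightarrow>\<^sub>0 rat) set \<Rightarrow> ('c \<Rightarrow>\<^sub>0 rat) set \<Rightarrow> (('b \<Rightarrow>\<^sub>0 rat) \<Rightarrow> ('c \<Rightarrow>\<^sub>0 rat)) \<Rightarrow> bool" where
  "linear_between V V' f \<longleftrightarrow> f ` V \<subseteq> V' \<and>
     (\<forall>x\<in>V. \<forall>y\<in>V. f (x + y) = f x + f y) \<and> (\<forall>c. \<forall>x\<in>V. f (smul c x) = smul c (f x))"


type_synonym 'a galg = "'a endo \<Rightarrow>\<^sub>0 rat"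

text \<open>The product of the group algebra. It cannot be the instance of \<open>times\<close> for \<open>\<Rightarrow>\<^sub>0\<close>, which
  convolves with respect to addition of keys.\<close>

definition galg_mult :: "'a galg \<Rightarrow> 'a galg \<Rightarrow> 'a galg" where
  "galg_mult p q = (\<Sum>u\<in>Poly_Mapping.keys p. \<Sum>v\<in>Poly_Mapping.keys q.
     Poly_Mapping.single (u \<circ> v) (Poly_Mapping.lookup p u * Poly_Mapping.lookup q v))"

definition x_elt :: "(nat \<Rightarrow> 'a::euclidean_space) \<Rightarrow> nat \<Rightarrow> 'a set \<Rightarrow> 'a set \<Rightarrow> 'a galg" where
  "x_elt e n J K = (\<Sum>d\<in>parabolic J \<inter> X e n K. Poly_Mapping.single d 1)"

definition x_class :: "(nat \<Rightarrow> 'a::euclidean_space) \<Rightarrow> nat \<Rightarrow> 'a set \<Rightarrow> 'a set \<Rightarrow> 'a galg set" where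
  "x_class e n J K = {x_elt e n J L | L. conj_subsets e n K L \<and> L \<subseteq> J}"

type_synonym 'a Sig = "'a galg set \<Rightarrow>\<^sub>0 rat"

definition Sig :: "(nat \<Rightarrow> 'a::euclidean_space) \<Rightarrow> nat \<Rightarrow> 'a set \<Rightarrow> 'a Sig set" where
  "Sig e n J = free_space {x_class e n J K | K. K \<subseteq> J}"

definition bx :: "(nat \<Rightarrow> 'a::euclidean_space) \<Rightarrow> nat \<Rightarrow> 'a set \<Rightarrow> 'a set \<Rightarrow> 'a Sig" where
  "bx e n J K = Poly_Mapping.single (x_class e n J K) 1"


text \<open>A \<open>G\<close>-set, for \<open>G \<le> W\<close>, is a pair of an underlying set and an action. Isomorphism classes
  are formed among the \<open>G\<close>-sets whose points are sets of group elements; this universe contains all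
  coset spaces.\<close>

type_synonym 'a gset = "'a endo set set \<times> ('a endo \<Rightarrow> 'a endo set \<Rightarrow> 'a endo set)"

definition gset_iso :: "'a endo monoid \<Rightarrow> 'a gset \<Rightarrow> 'a gset \<Rightarrow> bool" where
  "gset_iso G S T \<longleftrightarrow> (\<exists>f. bij_betw f (fst S) (fst T) \<and>
     (\<forall>g\<in>carrier G. \<forall>x\<in>fst S. f (snd S g x) = snd T g (f x)))"

definition gset_class :: "'a endo monoid \<Rightarrow> 'a gset \<Rightarrow> 'a gset set" where
  "gset_class G S = {T. group_action G (fst T) (snd T) \<and> gset_iso G S T}"

definition parabolic_group :: "'a::euclidean_space set \<Rightarrow> 'a endo monoid" where
  "parabolic_group J = BijGroup UNIV \<lparr>carrier := parabolic J\<rparr>"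

definition coset_gset :: "'a::euclidean_space set \<Rightarrow> 'a set \<Rightarrow> 'a gset" where
  "coset_gset J K =
    (let G = parabolic_group J; E = {d <#\<^bsub>G\<^esub> parabolic K | d. d \<in> carrier G}
     in (E, \<lambda>g. \<lambda>C\<in>E. g <#\<^bsub>G\<^esub> C))"

definition coset_class :: "'a::euclidean_space set \<Rightarrow> 'a set \<Rightarrow> 'a gset set" where
  "coset_class J K = gset_class (parabolic_group J) (coset_gset J K)"

type_synonym 'a PB = "'a gset set \<Rightarrow>\<^sub>0 rat"

definition PB :: "'a::euclidean_space set \<Rightarrow> 'a PB set" where
  "PB J = free_space {coset_class J K | K. K \<subseteq> J}"

definition bc :: "'a::euclidean_space set \<Rightarrow> 'a set \<Rightarrow> 'a PB" where
  "bc J K = Poly_Mapping.single (coset_class J K) 1"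


text \<open>Each of the following maps is prescribed on all basis vectors, by a formula in a representative
  \<open>K\<close>. Each is therefore described by a predicate that determines it uniquely on its domain. For
  \<open>is_Theta\<close> and \<open>is_res\<close>, the existence of such a map is the independence of the formula of the
  representative, a real condition on \<open>J\<close>: for \<open>J = {e 1 - e 2, e 3 - e 4}\<close> the two one-element
  subsets of \<open>J\<close> are conjugate under \<open>W\<close> but not under \<open>W\<^sub>J\<close>, and no \<open>\<Theta>\<^sub>J\<close> exists.\<close>

definition is_Theta ::
    "(nat \<Rightarrow> 'a::euclidean_space) \<Rightarrow> nat \<Rightarrow> 'a set \<Rightarrow> ('a Sig \<Rightarrow> 'a PB) \<Rightarrow> bool" where
  "is_Theta e n J \<Theta> \<longleftrightarrow> linear_between (Sig e n J) (PB J) \<Theta> \<and>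
     (\<forall>K. K \<subseteq> J \<longrightarrow> \<Theta> (bx e n J K) = bc J K)"

text \<open>The bracket extends linearly from the elements \<open>x\<^sub>P\<^sup>M\<close>, \<open>P \<subseteq> M\<close>, to their span. They are
  linearly independent, so \<open>is_bracket e n M y\<close> holds for exactly one \<open>z\<close> when \<open>y\<close> is in the span.\<close>

definition is_bracket ::
    "(nat \<Rightarrow> 'a::euclidean_space) \<Rightarrow> nat \<Rightarrow> 'a set \<Rightarrow> 'a galg \<Rightarrow> 'a Sig \<Rightarrow> bool" where
  "is_bracket e n M y z \<longleftrightarrow> (\<forall>c. y = (\<Sum>P\<in>Pow M. smul (c P) (x_elt e n M P)) \<longrightarrow>
     z = (\<Sum>P\<in>Pow M. smul (c P) (bx e n M P)))"

definition is_ind ::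
    "(nat \<Rightarrow> 'a::euclidean_space) \<Rightarrow> nat \<Rightarrow> 'a set \<Rightarrow> 'a set \<Rightarrow> ('a Sig \<Rightarrow> 'a Sig) \<Rightarrow> bool" where
  "is_ind e n J M I \<longleftrightarrow> linear_between (Sig e n J) (Sig e n M) I \<and>
     (\<forall>K. K \<subseteq> J \<longrightarrow>
       is_bracket e n M (galg_mult (x_elt e n M J) (x_elt e n J K)) (I (bx e n J K)))"

text \<open>Below, \<open>d -` K\<close> is \<open>d\<^sup>-\<^sup>1(K)\<close>, as \<open>d\<close> is a bijection.\<close>

definition is_res ::
    "(nat \<Rightarrow> 'a::euclidean_space) \<Rightarrow> nat \<Rightarrow> 'a set \<Rightarrow> 'a set \<Rightarrow> ('a Sig \<Rightarrow> 'a Sig) \<Rightarrow> bool" where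
  "is_res e n J M R \<longleftrightarrow> linear_between (Sig e n M) (Sig e n J) R \<and>
     (\<forall>K. K \<subseteq> M \<longrightarrow> R (bx e n M K) = (\<Sum>d\<in>parabolic M \<inter> XX e n K J. bx e n J (J \<inter> d -` K)))"

definition is_PB_ind :: "'a::euclidean_space set \<Rightarrow> 'a set \<Rightarrow> ('a PB \<Rightarrow> 'a PB) \<Rightarrow> bool" where
  "is_PB_ind J M I \<longleftrightarrow> linear_between (PB J) (PB M) I \<and>
     (\<forall>K. K \<subseteq> J \<longrightarrow> I (bc J K) = bc M K)"

definition is_PB_res ::
    "(nat \<Rightarrow> 'a::euclidean_space) \<Rightarrow> nat \<Rightarrow> 'a set \<Rightarrow> 'a set \<Rightarrow> ('a PB \<Rightarrow> 'a PB) \<Rightarrow> bool" where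
  "is_PB_res e n J M R \<longleftrightarrow> linear_between (PB M) (PB J) R \<and>
     (\<forall>K. K \<subseteq> M \<longrightarrow> R (bc M K) = (\<Sum>d\<in>parabolic M \<inter> XX e n K J. bc J (J \<inter> d -` K)))"

end

theory Submission
  imports Defs "HOL-Analysis.Linear_Algebra"
begin

text \<open>Both identities are between linear maps, so they need checking only on basis vectors. There the first
  is immediate from the two parallel formulas for restriction, and the second amounts to
  \<open>ind [x\<^sub>K\<^sup>J] = [x\<^sub>K\<^sup>M]\<close>, that is, to \<open>x\<^sub>J\<^sup>M x\<^sub>K\<^sup>J = x\<^sub>K\<^sup>M\<close> in the group algebra: every element of
  \<open>W\<^sub>M \<inter> X\<^sub>K\<close> is uniquely a product of elements of \<open>W\<^sub>M \<inter> X\<^sub>J\<close> and \<open>W\<^sub>J \<inter> X\<^sub>K\<close>. For this one lets the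
  Weyl group permute the orthonormal basis, so that a root \<open>e\<^sub>i - e\<^sub>j\<close> is positive iff \<open>i < j\<close>.\<close>

section \<open>Linear maps on free spaces\<close>

lemma smul_zero_left [simp]: "smul 0 p = 0"
  by (rule poly_mapping_eqI) (simp add: smul_def Poly_Mapping.map.rep_eq when_def)

lemma smul_one [simp]: "smul 1 p = p"
  by (rule poly_mapping_eqI) (simp add: smul_def Poly_Mapping.map.rep_eq when_def)

lemma smul_single: "smul c (Poly_Mapping.single b d) = Poly_Mapping.single b (c * d)"
  by (simp add: smul_def)

lemma free_space_0 [simp]: "0 \<in> free_space B"
  by (simp add: free_space_def)

lemma free_space_single: "b \<in> B \<Longrightarrow> Poly_Mapping.single b c \<in> free_space B"
  by (simp add: free_space_def)

lemma free_space_add: "x \<in> free_space B \<Longrightarrow> y \<in> free_space B \<Longrightarrow> x + y \<in> free_space B"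
  unfolding free_space_def using keys_add[of x y] by auto

lemma free_space_sum:
  assumes "\<And>i. i \<in> A \<Longrightarrow> g i \<in> free_space B"
  shows "sum g A \<in> free_space B"
  using assms by (induction A rule: infinite_finite_induct) (auto intro: free_space_add)

lemma linear_between_0:
  assumes "linear_between (free_space B) V f"
  shows "f 0 = 0"
  using assms unfolding linear_between_def by (metis free_space_0 smul_zero_left)

lemma linear_between_sum:
  assumes f: "linear_between (free_space B) V f" and g: "\<And>i. i \<in> A \<Longrightarrow> g i \<in> free_space B"
  shows "f (sum g A) = (\<Sum>i\<in>A. f (g i))"
  using g
proof (induction A rule: infinite_finite_induct)
  case (insert i A)
  then have "f (g i + sum g A) = f (g i) + f (sum g A)"
    using f free_space_sum[of A g B] unfolding linear_between_def by auto
  with insert show ?case by auto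
qed (auto simp: linear_between_0[OF f])

lemma linear_between_comp:
  assumes "linear_between U V f" "linear_between V V' g"
  shows "linear_between U V' (\<lambda>x. g (f x))"
  using assms unfolding linear_between_def by (auto simp: image_subset_iff)

text \<open>A vector is the finite combination of the basis vectors at its keys, and both maps
  commute with this combination.\<close>

lemma linear_between_eqI:
  assumes f: "linear_between (free_space B) V f" and g: "linear_between (free_space B) V g"
    and eq: "\<And>b. b \<in> B \<Longrightarrow> f (Poly_Mapping.single b 1) = g (Poly_Mapping.single b 1)"
    and x: "x \<in> free_space B"
  shows "f x = g x"
proof -
  have keys: "b \<in> B" if "b \<in> Poly_Mapping.keys x" for b
    using x that by (auto simp: free_space_def)
  have expand: "x = (\<Sum>b\<in>Poly_Mapping.keys x. smul (Poly_Mapping.lookup x b) (Poly_Mapping.single b 1))"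
    by (rule poly_mapping_eqI)
      (simp add: smul_single lookup_sum lookup_single when_def in_keys_iff)
  have expand_linear: "h x = (\<Sum>b\<in>Poly_Mapping.keys x. smul (Poly_Mapping.lookup x b) (h (Poly_Mapping.single b 1)))"
    if h: "linear_between (free_space B) V h" for h
  proof -
    have "h x = (\<Sum>b\<in>Poly_Mapping.keys x. h (smul (Poly_Mapping.lookup x b) (Poly_Mapping.single b 1)))"
      by (subst expand, rule linear_between_sum[OF h])
        (auto simp: smul_single intro: free_space_single keys)
    also have "\<dots> = (\<Sum>b\<in>Poly_Mapping.keys x. smul (Poly_Mapping.lookup x b) (h (Poly_Mapping.single b 1)))"
      using h keys by (intro sum.cong refl) (auto simp: linear_between_def free_space_single)
    finally show ?thesis .
  qed
  show ?thesis
    unfolding expand_linear[OF f] expand_linear[OF g] using keys eq by (intro sum.cong) auto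
qed

lemma linear_between_Sig_eqI:
  assumes "linear_between (Sig e n J) V f" "linear_between (Sig e n J) V g"
    and "\<And>K. K \<subseteq> J \<Longrightarrow> f (bx e n J K) = g (bx e n J K)" and "x \<in> Sig e n J"
  shows "f x = g x"
  using assms unfolding Sig_def bx_def by (elim linear_between_eqI) auto

section \<open>Multiplicity-free sums in the group algebra\<close>

lemma lookup_sum_single:
  assumes "finite A"
  shows "Poly_Mapping.lookup (\<Sum>u\<in>A. Poly_Mapping.single u (1::rat)) w = (if w \<in> A then 1 else 0)"
  using assms by (simp add: lookup_sum lookup_single when_def)

lemma keys_sum_single:
  assumes "finite A"
  shows "Poly_Mapping.keys (\<Sum>u\<in>A. Poly_Mapping.single u (1::rat)) = A"
  using assms by (auto simp: in_keys_iff lookup_sum_single split: if_splits)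

text \<open>Each \<open>x_elt\<close> has this shape. The sum runs over pairs, so a product
  \<open>u \<circ> v\<close> arising from several pairs is counted with multiplicity.\<close>

lemma galg_mult_sum_single:
  assumes "finite A" "finite B"
  shows "galg_mult (\<Sum>u\<in>A. Poly_Mapping.single u 1) (\<Sum>v\<in>B. Poly_Mapping.single v 1)
    = (\<Sum>(u, v)\<in>A \<times> B. Poly_Mapping.single (u \<circ> v) 1)"
  unfolding galg_mult_def keys_sum_single[OF assms(1)] keys_sum_single[OF assms(2)]
    sum.cartesian_product[symmetric]
  by (intro sum.cong refl) (simp add: lookup_sum_single assms)

section \<open>Reflection groups\<close>

lemma linear_reflection: "linear (reflection r)"
  unfolding reflection_def
  by (rule linearI) (auto simp: inner_add_left add_divide_distrib algebra_simps)

lemma reflection_reflection [simp]: "reflection r (reflection r v) = v"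
  \<comment> \<open>The quotient by \<open>inner r r\<close> cancels only for nonzero
    \<open>r\<close>; the reflection in 0 is the identity.\<close>
  by (cases "r = 0") (auto simp: reflection_def inner_diff_left algebra_simps)

lemma reflection_in_Bij: "reflection r \<in> Bij UNIV"
  unfolding Bij_def by (auto intro!: o_bij[of "reflection r"])

lemma reflections_subset: "reflection ` R \<subseteq> carrier (BijGroup UNIV)"
  using reflection_in_Bij by (auto simp: BijGroup_def)

lemma mult_BijGroup_UNIV:
  "f \<in> Bij UNIV \<Longrightarrow> g \<in> Bij UNIV \<Longrightarrow> f \<otimes>\<^bsub>BijGroup UNIV\<^esub> g = f \<circ> g"
  by (auto simp: BijGroup_def compose_def)

lemma one_BijGroup_UNIV: "\<one>\<^bsub>BijGroup UNIV\<^esub> = id"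
  by (auto simp: BijGroup_def)

lemma inv_BijGroup_UNIV: "f \<in> Bij UNIV \<Longrightarrow> inv\<^bsub>BijGroup UNIV\<^esub> f = inv_into UNIV f"
  by (auto simp: inv_BijGroup)

lemma refl_group_Bij: "w \<in> refl_group R \<Longrightarrow> w \<in> Bij UNIV"
  using group.generate_in_carrier[OF group_BijGroup reflections_subset]
  unfolding refl_group_def by (auto simp: BijGroup_def)

lemma refl_group_bij: "w \<in> refl_group R \<Longrightarrow> bij w"
  using refl_group_Bij by (auto simp: Bij_def)

lemma refl_group_id: "id \<in> refl_group R"
  unfolding refl_group_def one_BijGroup_UNIV[symmetric] by (rule generate.one)

lemma refl_group_reflection: "r \<in> R \<Longrightarrow> reflection r \<in> refl_group R"
  unfolding refl_group_def by (auto intro: generate.incl)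

lemma refl_group_comp: "u \<in> refl_group R \<Longrightarrow> v \<in> refl_group R \<Longrightarrow> u \<circ> v \<in> refl_group R"
  using generate.eng[of u "BijGroup UNIV" "reflection ` R" v] refl_group_Bij[of u R]
    refl_group_Bij[of v R]
  by (simp add: refl_group_def mult_BijGroup_UNIV)

lemma refl_group_inv: "w \<in> refl_group R \<Longrightarrow> inv_into UNIV w \<in> refl_group R"
  using group.generate_m_inv_closed[OF group_BijGroup reflections_subset, of w R]
    refl_group_Bij[of w R]
  by (simp add: refl_group_def inv_BijGroup_UNIV)

lemma refl_group_mono: "R \<subseteq> S \<Longrightarrow> refl_group R \<subseteq> refl_group S"
  unfolding refl_group_def by (intro group.mono_generate[OF group_BijGroup] image_mono)

text \<open>Reflections are involutions, so the inverse case of \<open>generate\<close> reduces to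
  the generator case.\<close>

lemma refl_group_induct [consumes 1, case_names id reflection comp]:
  assumes "w \<in> refl_group R"
    and id: "P id" and refl: "\<And>r. r \<in> R \<Longrightarrow> P (reflection r)"
    and comp: "\<And>u v. u \<in> refl_group R \<Longrightarrow> v \<in> refl_group R \<Longrightarrow> P u \<Longrightarrow> P v \<Longrightarrow> P (u \<circ> v)"
  shows "P w"
  using assms(1) unfolding refl_group_def
proof (induction rule: generate.induct)
  case one
  then show ?case using id by (simp only: one_BijGroup_UNIV)
next
  case (incl h)
  then show ?case using refl by auto
next
  case (inv h)
  then obtain r where r: "r \<in> R" "h = reflection r" by auto
  have "inv_into UNIV (reflection r) = reflection r"
    by (rule inv_equality) auto
  then have "inv\<^bsub>BijGroup UNIV\<^esub> h = reflection r"
    unfolding r(2) inv_BijGroup_UNIV[OF reflection_in_Bij] .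
  then show ?case using r refl by metis
next
  case (eng h1 h2)
  then have "h1 \<in> refl_group R" "h2 \<in> refl_group R" by (auto simp: refl_group_def)
  with eng.IH show ?case
    unfolding mult_BijGroup_UNIV[OF \<open>h1 \<in> refl_group R\<close>[THEN refl_group_Bij]
        \<open>h2 \<in> refl_group R\<close>[THEN refl_group_Bij]] by (intro comp)
qed

lemma linear_refl_group: "w \<in> refl_group R \<Longrightarrow> linear w"
  by (induction rule: refl_group_induct) (simp_all only: linear_id linear_reflection linear_compose)

text \<open>A reflection in \<open>r\<close> changes a vector only by a multiple of
  \<open>r\<close>, which is invisible to a \<open>z\<close> orthogonal to \<open>r\<close>. Later
  \<open>z\<close> is a fundamental weight attached to a simple root outside
  \<open>J\<close>.\<close>

lemma refl_group_inner_orthogonal: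
  assumes "w \<in> refl_group R" and "\<And>r. r \<in> R \<Longrightarrow> inner r z = 0"
  shows "inner (w x) z = inner x z"
  using assms(1)
  by (induction arbitrary: x rule: refl_group_induct)
    (auto simp: reflection_def inner_diff_left assms(2))

section \<open>The Weyl group of type A\<close>

text \<open>The vectors \<open>\<Sum>i\<in>{1..k}. e i\<close> below are the fundamental weights, up to their component
  along \<open>\<Sum>i\<in>{1..n+1}. e i\<close>.\<close>

context
  fixes e :: "nat \<Rightarrow> 'a::euclidean_space" and n :: nat
  assumes onb: "onb e n"
begin

section \<open>Orthonormal basis, weights and positive roots\<close>

lemma inner_basis: "i \<in> {1..n+1} \<Longrightarrow> j \<in> {1..n+1} \<Longrightarrow> inner (e i) (e j) = (if i = j then 1 else 0)"
  using onb by (auto simp: onb_def)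

lemma inj_on_basis: "inj_on e {1..n+1}"
  by (rule inj_onI) (metis inner_basis zero_neq_one)

lemma inner_weight:
  assumes "i \<in> {1..n+1}" "k \<in> {1..n+1}"
  shows "inner (e i) (\<Sum>j\<in>{1..k}. e j) = (if i \<le> k then 1 else 0)"
proof -
  have "inner (e i) (\<Sum>j\<in>{1..k}. e j) = (\<Sum>j\<in>{1..k}. if i = j then 1 else 0)"
    unfolding inner_sum_right using assms by (intro sum.cong) (auto simp: inner_basis)
  then show ?thesis using assms by auto
qed

lemma inner_height:
  assumes "i \<in> {1..n+1}"
  shows "inner (e i) (\<Sum>j\<in>{1..n+1}. real j *\<^sub>R e j) = real i"
proof -
  have "inner (e i) (\<Sum>j\<in>{1..n+1}. real j *\<^sub>R e j) = (\<Sum>j\<in>{1..n+1}. if i = j then real j else 0)"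
    unfolding inner_sum_right using assms by (intro sum.cong) (auto simp: inner_basis)
  then show ?thesis using assms by auto
qed

lemma span_basis: "span (e ` {1..n+1}) = UNIV"
proof -
  have "independent (e ` {1..n+1})"
  proof (rule pairwise_orthogonal_independent)
    show "pairwise orthogonal (e ` {1..n+1})"
      by (auto simp: pairwise_def orthogonal_def inner_basis)
    show "0 \<notin> e ` {1..n+1}"
      using inner_basis by fastforce
  qed
  moreover have "card (e ` {1..n+1}) = DIM('a)"
    using onb card_image[OF inj_on_basis] by (simp add: onb_def)
  ultimately have "UNIV \<subseteq> span (e ` {1..n+1})"
    by (intro card_ge_dim_independent) auto
  then show ?thesis by blast
qed

lemma finite_simple_roots: "finite (simple_roots e n)"
proof -
  have "simple_roots e n = (\<lambda>i. e i - e (i + 1)) ` {1..n}"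
    by (auto simp: simple_roots_def)
  then show ?thesis by simp
qed

lemma simple_roots_subset_roots: "simple_roots e n \<subseteq> roots e n"
  unfolding simple_roots_def roots_def by fastforce

text \<open>The difference telescopes into consecutive simple roots. Allowing \<open>a = b\<close>
  lets the induction start from the zero combination.\<close>

lemma diff_in_simple_span:
  assumes "a \<le> b" "1 \<le> a" "b \<le> n + 1"
  shows "\<exists>c. (\<forall>s\<in>simple_roots e n. 0 \<le> c s) \<and> e a - e b = (\<Sum>s\<in>simple_roots e n. c s *\<^sub>R s)"
  using assms
proof (induction b rule: dec_induct)
  case base
  then show ?case by (intro exI[of _ "\<lambda>_. 0"]) auto
next
  case (step b)
  then obtain c where c: "\<forall>s\<in>simple_roots e n. 0 \<le> c s"
      "e a - e b = (\<Sum>s\<in>simple_roots e n. c s *\<^sub>R s)"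
    by auto
  let ?t = "e b - e (b + 1)"
  have t: "?t \<in> simple_roots e n"
    using step by (auto simp: simple_roots_def)
  let ?d = "\<lambda>s. c s + (if s = ?t then 1 else 0)"
  have "(\<Sum>s\<in>simple_roots e n. ?d s *\<^sub>R s)
      = (\<Sum>s\<in>simple_roots e n. c s *\<^sub>R s) + (\<Sum>s\<in>simple_roots e n. if s = ?t then s else 0)"
    unfolding sum.distrib[symmetric] by (intro sum.cong) (auto simp: scaleR_left_distrib)
  also have "\<dots> = e a - e (Suc b)"
    using t unfolding c(2)[symmetric] by (simp add: finite_simple_roots)
  finally show ?case
    using c by (intro exI[of _ ?d]) auto
qed

text \<open>One direction is the telescoping sum. For the other, pair with the weight at
  \<open>b\<close>: a positive root pairs nonnegatively with it, which rules out
  \<open>a > b\<close>.\<close>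

lemma diff_in_pos_roots_iff:
  assumes ab: "a \<in> {1..n+1}" "b \<in> {1..n+1}"
  shows "e a - e b \<in> pos_roots e n \<longleftrightarrow> a < b"
proof
  assume "a < b"
  then have "e a - e b \<in> roots e n"
    unfolding roots_def mem_Collect_eq using ab by (intro exI[of _ a] exI[of _ b]) auto
  then show "e a - e b \<in> pos_roots e n"
    using diff_in_simple_span[of a b] ab \<open>a < b\<close> by (auto simp: pos_roots_def)
next
  assume pos: "e a - e b \<in> pos_roots e n"
  then obtain c where c: "\<forall>s\<in>simple_roots e n. 0 \<le> c s"
      "e a - e b = (\<Sum>s\<in>simple_roots e n. c s *\<^sub>R s)"
    by (auto simp: pos_roots_def)
  \<comment> \<open>The simple root \<open>e i - e (i + 1)\<close> pairs to 1 with this weight if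
    \<open>i = b\<close> and to 0 otherwise.\<close>
  have "0 \<le> inner s (\<Sum>j\<in>{1..b}. e j)" if "s \<in> simple_roots e n" for s
    using that ab inner_weight[of _ b] by (auto simp: simple_roots_def inner_diff_left)
  then have "0 \<le> inner (e a - e b) (\<Sum>j\<in>{1..b}. e j)"
    using c by (auto simp: inner_sum_left intro!: sum_nonneg)
  then have "a \<le> b"
    using ab inner_weight[of a b] inner_weight[of b b] by (auto simp: inner_diff_left split: if_splits)
  moreover have "e a - e b \<noteq> 0"
    using pos inj_on_basis by (auto simp: pos_roots_def roots_def inj_on_def)
  ultimately show "a < b" by (cases "a = b") auto
qed

section \<open>The Weyl group as a finite permutation group of the basis\<close>

text \<open>The reflection in \<open>e i - e j\<close> swaps these two basis vectors and fixes the
  others.\<close>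

lemma Weyl_basis_subset:
  assumes "w \<in> Weyl e n"
  shows "w ` e ` {1..n+1} \<subseteq> e ` {1..n+1}"
  using assms unfolding Weyl_def
proof (induction rule: refl_group_induct)
  case (reflection r)
  then obtain i j where r: "r = e i - e j" "i \<in> {1..n+1}" "j \<in> {1..n+1}" "i \<noteq> j"
    by (auto simp: roots_def)
  have "reflection r (e k) = (if k = i then e j else if k = j then e i else e k)"
    if "k \<in> {1..n+1}" for k
    using r that inner_basis by (auto simp: reflection_def inner_diff_left inner_diff_right)
  then show ?case using r by auto
next
  case (comp u v)
  then show ?case unfolding image_comp[symmetric] by blast
qed auto

lemma Weyl_perm:
  assumes "w \<in> Weyl e n"
  obtains p where "\<And>i. i \<in> {1..n+1} \<Longrightarrow> p i \<in> {1..n+1}"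
    and "\<And>i. i \<in> {1..n+1} \<Longrightarrow> w (e i) = e (p i)"
    and "inj_on p {1..n+1}"
proof -
  have "\<forall>i\<in>{1..n+1}. \<exists>j\<in>{1..n+1}. w (e i) = e j"
    using Weyl_basis_subset[OF assms] by blast
  then obtain p where p: "\<forall>i\<in>{1..n+1}. p i \<in> {1..n+1} \<and> w (e i) = e (p i)"
    by metis
  moreover have "inj w"
    using assms refl_group_bij by (auto simp: Weyl_def bij_def)
  then have "inj_on p {1..n+1}"
    using p inj_on_basis by (metis (no_types, lifting) inj_on_def UNIV_I)
  ultimately show ?thesis using that by blast
qed

lemma Weyl_diff: "w \<in> Weyl e n \<Longrightarrow> w (x - y) = w x - w y"
  using linear_diff[OF linear_refl_group] by (auto simp: Weyl_def)

lemma Weyl_eqI: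
  assumes "u \<in> Weyl e n" "v \<in> Weyl e n" and "\<And>i. i \<in> {1..n+1} \<Longrightarrow> u (e i) = v (e i)"
  shows "u = v"
proof
  fix x
  have "linear u" "linear v"
    using assms(1,2) linear_refl_group by (auto simp: Weyl_def)
  moreover have "x \<in> span (e ` {1..n+1})"
    unfolding span_basis by simp
  ultimately show "u x = v x"
    using assms(3) by (auto elim!: linear_eq_on_span[of u v "e ` {1..n+1}"] simp del: One_nat_def)
qed

text \<open>Restriction to the finite basis is injective on the group, by linearity, and takes
  values in the self-maps of the basis.\<close>

lemma finite_Weyl: "finite (Weyl e n)"
proof -
  let ?B = "e ` {1..n+1}"
  have "(\<lambda>w. restrict w ?B) ` Weyl e n \<subseteq> ?B \<rightarrow>\<^sub>E ?B"
    using Weyl_basis_subset by (fastforce simp: PiE_def)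
  then have "finite ((\<lambda>w. restrict w ?B) ` Weyl e n)"
    by (rule finite_subset) (auto intro: finite_PiE)
  moreover have "inj_on (\<lambda>w. restrict w ?B) (Weyl e n)"
  proof (rule inj_onI)
    fix u v assume uv: "u \<in> Weyl e n" "v \<in> Weyl e n" "restrict u ?B = restrict v ?B"
    then have "u (e i) = v (e i)" if "i \<in> {1..n+1}" for i
      using that by (metis image_eqI restrict_apply')
    then show "u = v" using uv Weyl_eqI by blast
  qed
  ultimately show ?thesis by (rule finite_imageD)
qed

lemma parabolic_subset_Weyl: "J \<subseteq> simple_roots e n \<Longrightarrow> parabolic J \<subseteq> Weyl e n"
  unfolding Weyl_def using simple_roots_subset_roots by (intro refl_group_mono) auto

section \<open>Distinguished representatives and their factorization\<close>

text \<open>Positivity on each consecutive root says that the permutation of \<open>u\<close>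
  increases at each step from \<open>a\<close> to \<open>b\<close>, hence
  \<open>p a < p b\<close>.\<close>

lemma X_consecutive:
  assumes u: "u \<in> X e n J" and "a < b" "1 \<le> a" "b \<le> n + 1"
    and "\<And>k. a \<le> k \<Longrightarrow> k < b \<Longrightarrow> e k - e (k + 1) \<in> J"
  shows "u (e a - e b) \<in> pos_roots e n"
proof -
  have uW: "u \<in> Weyl e n" using u by (simp add: X_def)
  obtain p where p: "\<And>i. i \<in> {1..n+1} \<Longrightarrow> p i \<in> {1..n+1}"
      "\<And>i. i \<in> {1..n+1} \<Longrightarrow> u (e i) = e (p i)"
    using Weyl_perm[OF uW] by metis
  have step: "p k < p (Suc k)" if "a \<le> k" "k < b" for k
  proof -
    have "u (e k - e (k + 1)) \<in> pos_roots e n"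
      using u assms that by (auto simp: X_def)
    then have "e (p k) - e (p (k + 1)) \<in> pos_roots e n"
      using p(2)[of k] p(2)[of "k + 1"] that assms by (simp add: Weyl_diff[OF uW])
    then show ?thesis
      using diff_in_pos_roots_iff[of "p k" "p (k + 1)"] p(1)[of k] p(1)[of "k + 1"] that assms by auto
  qed
  have "p a < p b"
    using \<open>a < b\<close> step
  proof (induction b)
    case (Suc b)
    show ?case
    proof (cases "a = b")
      case False
      then have "p a < p b" using Suc by auto
      also have "p b < p (Suc b)" using Suc.prems by auto
      finally show ?thesis .
    qed (use Suc.prems in auto)
  qed simp
  then show ?thesis
    using diff_in_pos_roots_iff[of "p a" "p b"] p(1)[of a] p(1)[of b] p(2)[of a] p(2)[of b] assms
    by (simp add: Weyl_diff[OF uW])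
qed

lemma simple_root_inner_weight:
  assumes "s \<in> simple_roots e n" "k \<in> {1..n}" "s \<noteq> e k - e (k + 1)"
  shows "inner s (\<Sum>j\<in>{1..k}. e j) = 0"
proof -
  obtain i where i: "i \<in> {1..n}" "s = e i - e (i + 1)"
    using assms by (auto simp: simple_roots_def)
  then have "i \<noteq> k" using assms by auto
  then show ?thesis
    using i assms inner_weight[of i k] inner_weight[of "i + 1" k] by (auto simp: inner_diff_left)
qed

text \<open>A root of the parabolic subsystem of \<open>J\<close> is a sum of consecutive elements of \<open>J\<close>, up to sign,
  because \<open>W\<^sub>J\<close> fixes the fundamental weights attached to the simple roots outside \<open>J\<close>.\<close>

lemma X_pos_roots_iff:
  assumes J: "J \<subseteq> simple_roots e n" and u: "u \<in> X e n J" and v: "v \<in> parabolic J" and s: "s \<in> J"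
  shows "u (v s) \<in> pos_roots e n \<longleftrightarrow> v s \<in> pos_roots e n"
proof -
  have uW: "u \<in> Weyl e n" using u by (simp add: X_def)
  have vW: "v \<in> Weyl e n" using v parabolic_subset_Weyl[OF J] by blast
  obtain i where i: "i \<in> {1..n}" "s = e i - e (i + 1)"
    using s J by (auto simp: simple_roots_def)
  obtain p where p: "\<And>i. i \<in> {1..n+1} \<Longrightarrow> p i \<in> {1..n+1}"
      "\<And>i. i \<in> {1..n+1} \<Longrightarrow> u (e i) = e (p i)" "inj_on p {1..n+1}"
    using Weyl_perm[OF uW] by metis
  obtain q where q: "\<And>i. i \<in> {1..n+1} \<Longrightarrow> q i \<in> {1..n+1}"
      "\<And>i. i \<in> {1..n+1} \<Longrightarrow> v (e i) = e (q i)" "inj_on q {1..n+1}"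
    using Weyl_perm[OF vW] by metis
  define a b where "a = q i" and "b = q (i + 1)"
  have ab: "a \<in> {1..n+1}" "b \<in> {1..n+1}" "a \<noteq> b"
    using q(1)[of i] q(1)[of "i + 1"] inj_onD[OF q(3), of i "i + 1"] i by (auto simp: a_def b_def)
  have vs: "v s = e a - e b"
    using q(2)[of i] q(2)[of "i + 1"] i by (simp add: Weyl_diff[OF vW] a_def b_def)
  \<comment> \<open>If the simple root at such a \<open>k\<close> were missing from
    \<open>J\<close>, \<open>v\<close> would preserve pairings with the weight at \<open>k\<close>.
    This pairing vanishes on \<open>s\<close>, but not on \<open>v s\<close>, because exactly one of
    \<open>a\<close>, \<open>b\<close> is at most \<open>k\<close>.\<close>
  have between: "e k - e (k + 1) \<in> J" if k: "min a b \<le> k" "k < max a b" for k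
  proof (rule ccontr)
    assume notin: "e k - e (k + 1) \<notin> J"
    have kn: "k \<in> {1..n}" using k ab by auto
    have orth: "inner r (\<Sum>j\<in>{1..k}. e j) = 0" if "r \<in> J" for r
      using simple_root_inner_weight[of r k] that J kn notin by blast
    have "inner (e a - e b) (\<Sum>j\<in>{1..k}. e j) = 0"
      using refl_group_inner_orthogonal[OF v orth, of s] orth[OF s] by (simp add: vs)
    then show False
      using inner_weight[of a k] inner_weight[of b k] ab k kn
      by (auto simp: inner_diff_left split: if_splits)
  qed
  have us: "u (e c - e d) = e (p c) - e (p d)" if "c \<in> {1..n+1}" "d \<in> {1..n+1}" for c d
    using p(2) that by (simp add: Weyl_diff[OF uW])
  show ?thesis
  proof (cases "a < b")
    case True
    then have "u (v s) \<in> pos_roots e n"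
      unfolding vs using X_consecutive[OF u, of a b] ab between by auto
    then show ?thesis using True ab by (simp add: vs diff_in_pos_roots_iff)
  next
    \<comment> \<open>Now \<open>b < a\<close>. The opposite root is positive and stays positive
      under \<open>u\<close>, so both sides of the equivalence are false.\<close>
    case False
    then have "u (e b - e a) \<in> pos_roots e n"
      using X_consecutive[OF u, of b a] ab between by auto
    then have "p b < p a"
      using ab p(1) by (simp add: us diff_in_pos_roots_iff)
    then show ?thesis
      using False ab p(1) by (simp add: vs us diff_in_pos_roots_iff)
  qed
qed

text \<open>The permutation of \<open>v\<close> increases at every \<open>k\<close>: by positivity
  if the simple root at \<open>k\<close> lies in \<open>J\<close>, and otherwise because
  \<open>v\<close> preserves the initial segment \<open>{1..k}\<close>. An increasing permutation is
  the identity.\<close>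

lemma parabolic_Int_X_trivial:
  assumes J: "J \<subseteq> simple_roots e n" and v: "v \<in> parabolic J" and pos: "v ` J \<subseteq> pos_roots e n"
  shows "v = id"
proof -
  have vW: "v \<in> Weyl e n" using v parabolic_subset_Weyl[OF J] by blast
  obtain p where p: "\<And>i. i \<in> {1..n+1} \<Longrightarrow> p i \<in> {1..n+1}"
      "\<And>i. i \<in> {1..n+1} \<Longrightarrow> v (e i) = e (p i)"
    using Weyl_perm[OF vW] by metis
  have step: "p k < p (k + 1)" if k: "k \<in> {1..n}" for k
  proof (cases "e k - e (k + 1) \<in> J")
    case True
    then have "v (e k - e (k + 1)) \<in> pos_roots e n" using pos by blast
    then show ?thesis
      using p(1)[of k] p(1)[of "k + 1"] p(2)[of k] p(2)[of "k + 1"] k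
      by (simp add: Weyl_diff[OF vW] diff_in_pos_roots_iff)
  next
    case False
    have orth: "inner r (\<Sum>j\<in>{1..k}. e j) = 0" if "r \<in> J" for r
      using simple_root_inner_weight[of r k] that J k False by blast
    \<comment> \<open>Equal pairings with the weight at \<open>k\<close> mean that
      \<open>p i \<le> k\<close> iff \<open>i \<le> k\<close>.\<close>
    have "inner (e (p i)) (\<Sum>j\<in>{1..k}. e j) = inner (e i) (\<Sum>j\<in>{1..k}. e j)" if "i \<in> {1..n+1}" for i
      using refl_group_inner_orthogonal[OF v orth, of "e i"] p(2)[OF that] by simp
    from this[of k] this[of "k + 1"] have "p k \<le> k" "\<not> p (k + 1) \<le> k"
      using k p(1)[of k] p(1)[of "k + 1"] inner_weight[of "p k" k] inner_weight[of "p (k + 1)" k]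
        inner_weight[of k k] inner_weight[of "k + 1" k]
      by (auto split: if_splits)
    then show ?thesis by simp
  qed
  have grow: "p i + d \<le> p (i + d)" if "1 \<le> i" "i + d \<le> n + 1" for i d
    using that
  proof (induction d)
    case (Suc d)
    then show ?case using step[of "i + d"] by auto
  qed simp
  \<comment> \<open>Growth from 1 up to \<open>i\<close> gives \<open>i \<le> p i\<close>; growth
    from \<open>i\<close> up to \<open>n + 1\<close> gives \<open>p i \<le> i\<close>.\<close>
  have "p i = i" if i: "i \<in> {1..n+1}" for i
    using i grow[of 1 "i - 1"] grow[of i "n + 1 - i"] p(1)[of 1] p(1)[of "n + 1"] by auto
  then show ?thesis
    using p(2) vW refl_group_id by (intro Weyl_eqI) (auto simp: Weyl_def)
qed

text \<open>The representative is found by maximising \<open>\<langle>u \<rho>, \<rho>\<rangle>\<close> over the coset, where \<open>\<rho> = \<Sum>k e\<^sub>k\<close> has product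
  \<open>-1\<close> with every simple root: multiplying \<open>u\<close> by the reflection in \<open>s\<close> adds \<open>\<langle>u s, \<rho>\<rangle>\<close>.\<close>

lemma coset_representative:
  assumes J: "J \<subseteq> simple_roots e n" and w: "w \<in> Weyl e n"
  obtains u v where "u \<in> X e n J" "v \<in> parabolic J" "w = u \<circ> v"
proof -
  let ?\<rho> = "\<Sum>j\<in>{1..n+1}. real j *\<^sub>R e j"
  let ?C = "(\<lambda>v. w \<circ> v) ` parabolic J"
  have fin: "finite ?C"
    using finite_subset[OF parabolic_subset_Weyl[OF J] finite_Weyl] by simp
  have ne: "?C \<noteq> {}" using refl_group_id by blast
  obtain u where u: "u \<in> ?C" and max: "\<And>u'. u' \<in> ?C \<Longrightarrow> inner (u' ?\<rho>) ?\<rho> \<le> inner (u ?\<rho>) ?\<rho>"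
  proof -
    let ?F = "\<lambda>u. inner (u ?\<rho>) ?\<rho>"
    have "Max (?F ` ?C) \<in> ?F ` ?C" using fin ne by (intro Max_in) auto
    then obtain u where "u \<in> ?C" "?F u = Max (?F ` ?C)" by force
    then show thesis using that fin by (metis (no_types, lifting) Max_ge finite_imageI imageI)
  qed
  from u obtain v where v: "v \<in> parabolic J" "u = w \<circ> v" by blast
  have uW: "u \<in> Weyl e n"
    using v w parabolic_subset_Weyl[OF J] refl_group_comp by (auto simp: Weyl_def)
  obtain p where p: "\<And>i. i \<in> {1..n+1} \<Longrightarrow> p i \<in> {1..n+1}"
      "\<And>i. i \<in> {1..n+1} \<Longrightarrow> u (e i) = e (p i)" "inj_on p {1..n+1}"
    using Weyl_perm[OF uW] by metis
  have "u s \<in> pos_roots e n" if s: "s \<in> J" for s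
  proof -
    obtain i where i: "i \<in> {1..n}" "s = e i - e (i + 1)"
      using s J by (auto simp: simple_roots_def)
    have us: "u s = e (p i) - e (p (i + 1))"
      using i p(2)[of i] p(2)[of "i + 1"] by (simp add: Weyl_diff[OF uW])
    have "inner ?\<rho> s = -1"
      unfolding inner_commute[of ?\<rho>] i(2) inner_diff_left
      using i(1) inner_height[of i] inner_height[of "i + 1"] by simp
    moreover have "inner s s = 2"
      using i inner_basis[of i i] inner_basis[of i "i + 1"] inner_basis[of "i + 1" i] inner_basis[of "i + 1" "i + 1"]
      by (simp add: inner_diff_left inner_diff_right)
    ultimately have "reflection s ?\<rho> = ?\<rho> + s"
      by (simp add: reflection_def)
    moreover have "linear u"
      using uW linear_refl_group by (auto simp: Weyl_def)
    ultimately have refl: "(u \<circ> reflection s) ?\<rho> = u ?\<rho> + u s"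
      by (simp add: linear_add)
    have "u \<circ> reflection s \<in> ?C"
    proof
      show "v \<circ> reflection s \<in> parabolic J"
        using v s refl_group_comp refl_group_reflection by blast
      show "u \<circ> reflection s = w \<circ> (v \<circ> reflection s)"
        by (simp add: v comp_assoc)
    qed
    \<comment> \<open>Maximality forbids an increase of the height pairing. In terms of the
      permutation this is \<open>p i \<le> p (i + 1)\<close>, and injectivity makes it
      strict.\<close>
    then have "inner (u s) ?\<rho> \<le> 0"
      using max[of "u \<circ> reflection s"] unfolding refl inner_add_left by linarith
    moreover have "inner (u s) ?\<rho> = real (p i) - real (p (i + 1))"
      unfolding us inner_diff_left
      using i(1) inner_height[OF p(1), of i] inner_height[OF p(1), of "i + 1"] by simp
    ultimately have "p i \<le> p (i + 1)"
      by linarith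
    moreover have "p i \<noteq> p (i + 1)"
      using inj_onD[OF p(3), of i "i + 1"] i by auto
    ultimately show ?thesis
      using p(1)[of i] p(1)[of "i + 1"] i(1) by (simp add: us diff_in_pos_roots_iff)
  qed
  then have "u \<in> X e n J" using uW by (auto simp: X_def)
  moreover have "inv_into UNIV v \<in> parabolic J" using v refl_group_inv by blast
  moreover have "w = u \<circ> inv_into UNIV v"
    using refl_group_bij[OF v(1)] by (auto simp: v fun_eq_iff bij_is_surj surj_f_inv_f)
  ultimately show ?thesis using that by blast
qed

text \<open>Everything rests on \<open>X_pos_roots_iff\<close>: an element of \<open>X e n J\<close>
  does not change the sign of a root \<open>v s\<close> with \<open>v\<close> in
  \<open>parabolic J\<close> and \<open>s\<close> in \<open>J\<close>. Hence for such products
  positivity on \<open>K\<close> can be tested on the right factor alone.\<close>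

lemma X_factorization:
  assumes KJ: "K \<subseteq> J" and JM: "J \<subseteq> M" and M: "M \<subseteq> simple_roots e n"
  shows "bij_betw (\<lambda>(u, v). u \<circ> v) ((parabolic M \<inter> X e n J) \<times> (parabolic J \<inter> X e n K))
    (parabolic M \<inter> X e n K)"
proof (rule bij_betw_imageI)
  have J: "J \<subseteq> simple_roots e n" using JM M by blast
  have JW: "parabolic J \<subseteq> Weyl e n" and JMp: "parabolic J \<subseteq> parabolic M"
    using parabolic_subset_Weyl[OF J] refl_group_mono[OF JM] by auto
  show "inj_on (\<lambda>(u, v). u \<circ> v) ((parabolic M \<inter> X e n J) \<times> (parabolic J \<inter> X e n K))"
  proof (rule inj_onI, clarify)
    fix u v u' v'
    assume u: "u \<in> X e n J" and u': "u' \<in> X e n J" and v: "v \<in> parabolic J" and v': "v' \<in> parabolic J"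
      and eq: "u \<circ> v = u' \<circ> v'"
    define t where "t = v \<circ> inv_into UNIV v'"
    have t: "t \<in> parabolic J"
      unfolding t_def using v v' refl_group_comp refl_group_inv by blast
    have u't: "u' x = u (t x)" for x
    proof -
      have "u' x = (u' \<circ> v') (inv_into UNIV v' x)"
        using refl_group_bij[OF v'] by (simp add: bij_is_surj surj_f_inv_f)
      then show ?thesis by (simp add: eq[symmetric] t_def)
    qed
    have "t ` J \<subseteq> pos_roots e n"
    proof clarify
      fix s assume s: "s \<in> J"
      then have "u (t s) \<in> pos_roots e n" using u' by (auto simp: X_def u't[symmetric])
      then show "t s \<in> pos_roots e n" using X_pos_roots_iff[OF J u t s] by simp
    qed
    then have "t = id" using parabolic_Int_X_trivial[OF J t] by simp
    then have uu: "u' = u" using u't by auto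
    have "inj u" using u refl_group_bij by (auto simp: X_def Weyl_def bij_def)
    then have "v = v'" using eq uu by (auto simp: fun_eq_iff dest: injD)
    with uu show "u = u' \<and> v = v'" by simp
  qed
  show "(\<lambda>(u, v). u \<circ> v) ` ((parabolic M \<inter> X e n J) \<times> (parabolic J \<inter> X e n K)) = parabolic M \<inter> X e n K"
  proof (intro equalityI subsetI)
    fix w assume "w \<in> (\<lambda>(u, v). u \<circ> v) ` ((parabolic M \<inter> X e n J) \<times> (parabolic J \<inter> X e n K))"
    then obtain u v where w: "w = u \<circ> v" and u: "u \<in> parabolic M" "u \<in> X e n J"
      and v: "v \<in> parabolic J" "v \<in> X e n K" by auto
    have "w \<in> parabolic M" unfolding w using u v JMp refl_group_comp by blast
    moreover have "w s \<in> pos_roots e n" if "s \<in> K" for s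
      using X_pos_roots_iff[OF J u(2) v(1), of s] that KJ v(2) by (auto simp: w X_def)
    ultimately show "w \<in> parabolic M \<inter> X e n K"
      using parabolic_subset_Weyl[OF M] by (auto simp: X_def)
  next
    fix w assume w: "w \<in> parabolic M \<inter> X e n K"
    then obtain u v where uv: "u \<in> X e n J" "v \<in> parabolic J" "w = u \<circ> v"
      using coset_representative[OF J] by (auto simp: X_def)
    \<comment> \<open>Since \<open>w\<close> and \<open>v\<close> both lie in
      \<open>parabolic M\<close>, so does the representative \<open>u\<close>, which was only known
      to lie in the Weyl group.\<close>
    have "u = w \<circ> inv_into UNIV v"
      using refl_group_bij[OF uv(2)] by (auto simp: uv(3) fun_eq_iff bij_is_surj surj_f_inv_f)
    then have "u \<in> parabolic M"
      using w refl_group_comp refl_group_inv[OF uv(2)] JMp by blast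
    moreover have "v s \<in> pos_roots e n" if "s \<in> K" for s
      using X_pos_roots_iff[OF J uv(1,2), of s] that KJ w by (auto simp: uv(3) X_def)
    then have "v \<in> X e n K" using uv(2) JW by (auto simp: X_def)
    ultimately show "w \<in> (\<lambda>(u, v). u \<circ> v) ` ((parabolic M \<inter> X e n J) \<times> (parabolic J \<inter> X e n K))"
      using uv by force
  qed
qed

section \<open>The induction map on basis vectors\<close>

text \<open>The product is a sum over pairs of factors; the factorization reindexes it so that each
  element of \<open>parabolic M \<inter> X e n K\<close> occurs exactly once.\<close>

lemma galg_mult_x_elt:
  assumes KJ: "K \<subseteq> J" and JM: "J \<subseteq> M" and M: "M \<subseteq> simple_roots e n"
  shows "galg_mult (x_elt e n M J) (x_elt e n J K) = x_elt e n M K"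
proof -
  have fin: "finite (parabolic L \<inter> X e n N)" for L N
    by (rule finite_subset[OF _ finite_Weyl]) (auto simp: X_def)
  show ?thesis
    unfolding x_elt_def galg_mult_sum_single[OF fin fin]
    using sum.reindex_bij_betw[OF X_factorization[OF assms], of "\<lambda>w. Poly_Mapping.single w (1::rat)"]
    by (simp add: case_prod_unfold)
qed

text \<open>The bracket prescribes \<open>z\<close> for every expansion of its argument; the
  expansion whose coefficients are the indicator of \<open>K\<close> yields the claimed
  value.\<close>

lemma is_bracket_x_elt:
  assumes "M \<subseteq> simple_roots e n" "K \<subseteq> M" and z: "is_bracket e n M (x_elt e n M K) z"
  shows "z = bx e n M K"
proof -
  have "finite (Pow M)" using assms finite_simple_roots finite_subset by blast
  then have delta: "(\<Sum>P\<in>Pow M. smul (if P = K then 1 else 0) (f P)) = f K" for f :: "'a set \<Rightarrow> 'b \<Rightarrow>\<^sub>0 rat"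
    using assms(2) by (simp add: if_distrib[of "\<lambda>c. smul c _"] cong: if_cong)
  show ?thesis
    using z[unfolded is_bracket_def, rule_format, of "\<lambda>P. if P = K then 1 else 0"] by (simp add: delta)
qed

lemma is_ind_bx:
  assumes "K \<subseteq> J" "J \<subseteq> M" "M \<subseteq> simple_roots e n" and ind: "is_ind e n J M ind"
  shows "ind (bx e n J K) = bx e n M K"
  using is_bracket_x_elt[of M K "ind (bx e n J K)"] assms galg_mult_x_elt[of K J M]
  by (auto simp: is_ind_def)

end

theorem theorem2p5:
  fixes e :: "nat \<Rightarrow> 'a::euclidean_space" and n :: nat and J M :: "'a set"
    and \<Theta>J \<Theta>M :: "'a Sig \<Rightarrow> 'a PB"
    and res ind :: "'a Sig \<Rightarrow> 'a Sig"
    and PBres PBind :: "'a PB \<Rightarrow> 'a PB"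
  assumes "onb e n"
    and "J \<subseteq> M" and "M \<subseteq> simple_roots e n"
    and "is_Theta e n J \<Theta>J" and "is_Theta e n M \<Theta>M"
    and "is_res e n J M res" and "is_ind e n J M ind"
    and "is_PB_res e n J M PBres" and "is_PB_ind J M PBind"
  shows "(\<forall>x\<in>Sig e n M. \<Theta>J (res x) = PBres (\<Theta>M x)) \<and>
         (\<forall>x\<in>Sig e n J. \<Theta>M (ind x) = PBind (\<Theta>J x))"
proof (intro conjI ballI)
  have \<Theta>J: "linear_between (Sig e n J) (PB J) \<Theta>J" "\<And>K. K \<subseteq> J \<Longrightarrow> \<Theta>J (bx e n J K) = bc J K"
    and \<Theta>M: "linear_between (Sig e n M) (PB M) \<Theta>M" "\<And>K. K \<subseteq> M \<Longrightarrow> \<Theta>M (bx e n M K) = bc M K"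
    using assms(4,5) by (auto simp: is_Theta_def)
  have res: "linear_between (Sig e n M) (Sig e n J) res"
      "\<And>K. K \<subseteq> M \<Longrightarrow> res (bx e n M K) = (\<Sum>d\<in>parabolic M \<inter> XX e n K J. bx e n J (J \<inter> d -` K))"
    and PBres: "linear_between (PB M) (PB J) PBres"
      "\<And>K. K \<subseteq> M \<Longrightarrow> PBres (bc M K) = (\<Sum>d\<in>parabolic M \<inter> XX e n K J. bc J (J \<inter> d -` K))"
    using assms(6,8) by (auto simp: is_res_def is_PB_res_def)
  have ind: "linear_between (Sig e n J) (Sig e n M) ind"
    and PBind: "linear_between (PB J) (PB M) PBind" "\<And>K. K \<subseteq> J \<Longrightarrow> PBind (bc J K) = bc M K"
    using assms(7,9) by (auto simp: is_ind_def is_PB_ind_def)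
  show "\<Theta>J (res x) = PBres (\<Theta>M x)" if "x \<in> Sig e n M" for x
  proof (rule linear_between_Sig_eqI[OF linear_between_comp[OF res(1) \<Theta>J(1)]
        linear_between_comp[OF \<Theta>M(1) PBres(1)] _ that])
    fix K assume K: "K \<subseteq> M"
    have bx: "bx e n J (J \<inter> d -` K) \<in> Sig e n J" for d
      unfolding Sig_def bx_def by (intro free_space_single) blast
    have "\<Theta>J (res (bx e n M K)) = (\<Sum>d\<in>parabolic M \<inter> XX e n K J. \<Theta>J (bx e n J (J \<inter> d -` K)))"
      unfolding res(2)[OF K]
      using \<Theta>J(1) bx unfolding Sig_def by (rule linear_between_sum)
    then show "\<Theta>J (res (bx e n M K)) = PBres (\<Theta>M (bx e n M K))"
      by (simp add: \<Theta>J(2) \<Theta>M(2) PBres(2) K)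
  qed
  show "\<Theta>M (ind x) = PBind (\<Theta>J x)" if "x \<in> Sig e n J" for x
  proof (rule linear_between_Sig_eqI[OF linear_between_comp[OF ind \<Theta>M(1)]
        linear_between_comp[OF \<Theta>J(1) PBind(1)] _ that])
    fix K assume K: "K \<subseteq> J"
    \<comment> \<open>This is where the factorization enters; afterwards both sides equal
      \<open>bc M K\<close>.\<close>
    have "ind (bx e n J K) = bx e n M K"
      using is_ind_bx[OF assms(1) K assms(2,3,7)] .
    moreover have "K \<subseteq> M" using K assms(2) by blast
    ultimately show "\<Theta>M (ind (bx e n J K)) = PBind (\<Theta>J (bx e n J K))"
      by (simp add: \<Theta>J(2) \<Theta>M(2) PBind(2) K)
  qed
qed

end
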